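(* Let $x>1$, let $m,v\ge 0$ and $n\ge 1$ be integers, and let $\alpha_0,\alpha_1,\dots,\alpha_m$ be real numbers. Then $$b_2(v,x;m,1,n;\alpha_0,\dots,\alpha_m)=(1-x)\sum_{j=0}^{m}\alpha_j\sum_{l=0}^{j}\binom{j}{l}\left(-\frac{2}{n}\right)^{j-l}\sum_{c=0}^{l}\binom{v}{c+1}\frac{(c+1)!\,\mathcal{S}_2(l+1,c+1)\,(1+x)^{v-1}}{2^{v}}.$$
   Context: For $\beta\in\mathbb{C}$ and an integer $r\ge 0$, $(\beta)^{\overline{r}}=\prod_{j=0}^{r-1}(\beta+j)$, with $(\beta)^{\overline{0}}=1$. The generalized hypergeometric function is $${}_pF_q\left[\begin{array}{c}\beta_1,\dots,\beta_p\\ \gamma_1,\dots,\gamma_q\end{array};z\right]=\sum_{r=0}^{\infty}\frac{\prod_{j=1}^{p}(\beta_j)^{\overline{r}}}{\prod_{j=1}^{q}(\gamma_j)^{\overline{r}}}\frac{z^r}{r!},\qquad {}_0F_0(z)=e^z.$$ For integers $m\ge 0$, $k,n\ge 1$, and real $t,x,\alpha_0,\dots,\alpha_m$, define $$S_2(t,x;m,k,n;\alpha_0,\dots,\alpha_m)=\frac{1}{k!}\left(\frac{1-x}{2}t\right)^{k}\sum_{j=0}^{m}\alpha_j\sum_{l=0}^{j}\binom{j}{l}\left(-\frac{2k}{n}\right)^{j-l}\,{}_lF_l\left[\begin{array}{c}k+1,\dots,k+1\\ k,\dots,k\end{array};\frac{1+x}{2}t\right],$$ where in ${}_lF_l$ all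 $l$ upper parameters equal $k+1$ and all $l$ lower parameters equal $k$. This is entire in $t$, and the numbers $b_2$ are defined by the expansion $$S_2(t,x;m,k,n;\alpha_0,\dots,\alpha_m)=\sum_{v=0}^{\infty}b_2(v,x;m,k,n;\alpha_0,\dots,\alpha_m)\frac{t^v}{v!}.$$ The Stirling numbers of the second kind are $\mathcal{S}_2(c,d)=\frac{1}{d!}\sum_{v=0}^{d}\binom{d}{v}(-1)^v(d-v)^c$, with $0^0=1$. Binomial coefficients $\binom{v}{r}$ with $r>v\ge 0$ are $0$. *)

theory Defs
  imports Complex_Main "HOL-Combinatorics.Stirling"
begin

definition hypergeom :: "'a::{real_normed_field,banach} list \<Rightarrow> 'a list \<Rightarrow> 'a \<Rightarrow> 'a" where
  "hypergeom bs cs z =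
     (\<Sum>r. (\<Prod>b\<leftarrow>bs. pochhammer b r) / (\<Prod>c\<leftarrow>cs. pochhammer c r) * (z ^ r / fact r))"

definition S2 :: "real \<Rightarrow> real \<Rightarrow> nat \<Rightarrow> nat \<Rightarrow> nat \<Rightarrow> (nat \<Rightarrow> real) \<Rightarrow> real" where
  "S2 t x m k n \<alpha> =
     1 / fact k * ((1 - x) / 2 * t) ^ k *
     (\<Sum>j=0..m. \<alpha> j *
        (\<Sum>l=0..j. real (j choose l) * (- (2 * real k / real n)) ^ (j - l) *
           hypergeom (replicate l (real k + 1)) (replicate l (real k)) ((1 + x) / 2 * t)))"

text \<open>
  The series is required to converge to \<^term>\<open>S2\<close> for every real argument (the function is entire),
  which determines the whole coefficient sequence; \<open>b2\<close> is its entry at \<open>v\<close>.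
\<close>
definition b2 :: "nat \<Rightarrow> real \<Rightarrow> nat \<Rightarrow> nat \<Rightarrow> nat \<Rightarrow> (nat \<Rightarrow> real) \<Rightarrow> real" where
  "b2 v x m k n \<alpha> =
     (THE b. \<forall>t. (\<lambda>u. b u * (t ^ u / fact u)) sums S2 t x m k n \<alpha>) v"

definition stirling2 :: "nat \<Rightarrow> nat \<Rightarrow> real" where
  "stirling2 c d =
     1 / fact d * (\<Sum>v=0..d. real (d choose v) * (- 1) ^ v * real (d - v) ^ c)"

text \<open>Agreement with the recursively defined \<^const>\<open>Stirling\<close> of the library.\<close>

lemma stirling2_Suc_Suc:
  "stirling2 (Suc c) (Suc d) = real (Suc d) * stirling2 c (Suc d) + stirling2 c d"
proof -
  define T where "T = (\<lambda>c d. \<Sum>v\<le>d. real (d choose v) * (- 1) ^ v * real (d - v) ^ c)"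
  have absorb: "real (Suc d choose v) * real (Suc d - v) = real (Suc d) * real (d choose v)"
    if "v \<le> Suc d" for v
  proof (cases "v = Suc d")
    case False
    with that have "v \<le> d" by simp
    then have "(Suc d - v) * (Suc d choose v) = Suc d * (d choose v)"
      using binomial_absorb_comp[of "Suc d" v] by simp
    then show ?thesis by (metis mult.commute of_nat_mult)
  qed simp
  have "T (Suc c) (Suc d) = (\<Sum>v\<le>Suc d. real (Suc d) * (real (d choose v) * (- 1) ^ v * real (Suc d - v) ^ c))"
    unfolding T_def
  proof (rule sum.cong[OF refl])
    fix v assume "v \<in> {..Suc d}"
    then have a: "real (Suc d choose v) * real (Suc d - v) = real (Suc d) * real (d choose v)"
      using absorb by simp
    have "real (Suc d choose v) * (- 1) ^ v * real (Suc d - v) ^ Suc c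
        = (real (Suc d choose v) * real (Suc d - v)) * ((- 1) ^ v * real (Suc d - v) ^ c)"
      by (simp only: power_Suc mult_ac)
    also have "\<dots> = real (Suc d) * (real (d choose v) * (- 1) ^ v * real (Suc d - v) ^ c)"
      unfolding a by (simp only: mult_ac)
    finally show "real (Suc d choose v) * (- 1) ^ v * real (Suc d - v) ^ Suc c = \<dots>" .
  qed
  also have "\<dots> = real (Suc d) * (\<Sum>v\<le>Suc d. real (d choose v) * (- 1) ^ v * real (Suc d - v) ^ c)"
    by (rule sum_distrib_left[symmetric])
  also have "(\<Sum>v\<le>Suc d. real (d choose v) * (- 1) ^ v * real (Suc d - v) ^ c) = T c (Suc d) + T c d"
    unfolding T_def by (simp only: sum.atMost_Suc_shift)
      (simp add: sum.distrib[symmetric] algebra_simps)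
  finally have rec: "T (Suc c) (Suc d) = real (Suc d) * (T c (Suc d) + T c d)" .
  have st: "stirling2 c d = T c d / fact d" for c d
    by (simp add: stirling2_def T_def atLeast0AtMost)
  show ?thesis
    unfolding st rec fact_Suc by (simp add: distrib_left add_divide_distrib)
qed

lemma stirling2_eq_Stirling: "stirling2 c d = real (Stirling c d)"
proof (induction c d rule: Stirling.induct)
  case (2 d)
  have "(\<Sum>v\<le>Suc d. real (Suc d choose v) * (- 1) ^ v) = (- 1 + 1) ^ Suc d"
    using binomial_ring[of "- 1 :: real" 1 "Suc d"] by simp
  then show ?case by (simp add: stirling2_def atLeast0AtMost)
next
  case (4 c d)
  then show ?case by (simp only: stirling2_Suc_Suc Stirling.simps of_nat_add of_nat_mult)
qed (simp_all add: stirling2_def)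

end

theory Submission
  imports Defs
begin

text \<open>
  The quotient of Pochhammer symbols \<open>(a + 1)\<^sub>r / (a)\<^sub>r\<close> telescopes to \<open>(a + r) / a\<close>.
  For \<open>k = 1\<close> every hypergeometric function in \<^const>\<open>S2\<close> is therefore
  \<open>\<Sum>r. (r + 1)^l z^r / r!\<close>, and the prefactor \<open>(1 - x) / 2 * t\<close> shifts the index by one: as
  \<open>t^(r + 1) / r! = (r + 1) t^(r + 1) / (r + 1)!\<close>, its product with that function has at
  \<open>t^u / u!\<close> the coefficient \<open>(1 - x) / 2 * u^(l + 1) ((1 + x) / 2)^(u - 1)\<close>. Since a power series that
  converges everywhere determines its coefficients, this computes \<^const>\<open>b2\<close>
  (\<open>S2_sums\<close>, \<open>b2_eqI\<close>).

  The stated formula is this one with the power \<open>u^(l + 1)\<close> expanded into falling factorials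
  \<open>c! (u choose c)\<close>, with Stirling numbers of the second kind as coefficients
  (\<open>power_eq_sum_Stirling_binomial\<close>).
\<close>

section \<open>Powers in terms of falling factorials\<close>

text \<open>
  Induction on the exponent. Multiplying the falling factorial \<open>k! (v choose k)\<close> by
  \<open>v = k + (v - k)\<close> gives \<open>k\<close> times itself plus the next falling factorial, which is the
  recurrence of the Stirling numbers.
\<close>
lemma power_eq_sum_Stirling_binomial:
  "v ^ p = (\<Sum>k\<le>p. Stirling p k * (fact k * (v choose k)))" for v p :: nat
proof (induction p)
  case 0
  then show ?case by simp
next
  case (Suc p)
  define F where "F k = fact k * (v choose k)" for k :: nat
  have step: "v * F k = k * F k + F (Suc k)" for k
  proof (cases "k \<le> v")
    case True
    have "F (Suc k) = fact k * (Suc k * (v choose Suc k))"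
      by (simp add: F_def algebra_simps)
    also have "Suc k * (v choose Suc k) = (v - k) * (v choose k)"
      using binomial_absorption[of k v] binomial_absorb_comp[of v k] by simp
    finally have "F (Suc k) = (v - k) * F k"
      by (simp add: F_def)
    then show ?thesis
      using True by (simp flip: distrib_right)
  qed (simp add: F_def binomial_eq_0)
  have "v ^ Suc p = (\<Sum>k\<le>p. Stirling p k * (v * F k))"
    unfolding power_Suc Suc.IH F_def sum_distrib_left by (simp only: mult_ac)
  also have "\<dots> = (\<Sum>k\<le>p. k * Stirling p k * F k) + (\<Sum>k\<le>p. Stirling p k * F (Suc k))"
    by (simp only: step distrib_left sum.distrib mult_ac)
  \<comment> \<open>Extending the first sum to \<open>Suc p\<close> adds the zero \<open>Stirling p (Suc p)\<close>; its term at 0 vanishes.\<close>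
  also have "(\<Sum>k\<le>p. k * Stirling p k * F k) = (\<Sum>k\<le>Suc p. k * Stirling p k * F k)"
    by simp
  also have "\<dots> = (\<Sum>k\<le>p. Suc k * Stirling p (Suc k) * F (Suc k))"
    by (simp only: sum.atMost_Suc_shift mult_0 add_0)
  also have "\<dots> + (\<Sum>k\<le>p. Stirling p k * F (Suc k))
      = (\<Sum>k\<le>p. Stirling (Suc p) (Suc k) * F (Suc k))"
    by (simp only: Stirling.simps distrib_right sum.distrib)
  also have "\<dots> = (\<Sum>k\<le>Suc p. Stirling (Suc p) k * F k)"
    by (simp only: sum.atMost_Suc_shift) simp
  finally show ?case
    by (simp only: F_def)
qed

corollary power_Suc_eq_sum_stirling2:
  "real v ^ Suc l
    = (\<Sum>c=0..l. real (v choose (c + 1)) * fact (c + 1) * stirling2 (l + 1) (c + 1))"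
proof -
  have "real v ^ Suc l = real (\<Sum>k\<le>Suc l. Stirling (Suc l) k * (fact k * (v choose k)))"
    by (simp only: power_eq_sum_Stirling_binomial flip: of_nat_power)
  also have "(\<Sum>k\<le>Suc l. Stirling (Suc l) k * (fact k * (v choose k)))
      = (\<Sum>c\<le>l. Stirling (Suc l) (Suc c) * (fact (Suc c) * (v choose Suc c)))"
    by (simp only: sum.atMost_Suc_shift) simp
  finally show ?thesis
    by (simp add: stirling2_eq_Stirling atLeast0AtMost mult_ac del: Stirling.simps fact_Suc)
qed

section \<open>The hypergeometric functions\<close>

lemma pochhammer_quotient_add_1:
  "pochhammer (a + 1) r / pochhammer a r = (a + real r) / a" if "a > 0" for a :: real
proof -
  have "a * pochhammer (a + 1) r = (a + real r) * pochhammer a r"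
    using pochhammer_rec[of a r] pochhammer_rec'[of a r] by simp
  then show ?thesis
    using that pochhammer_pos[OF that, of r] by (simp add: field_simps)
qed

text \<open>
  Comparison with an exponential series: \<open>y^l / l!\<close> is a single term of the series of \<open>exp y\<close>, so
  the factor \<open>((a + r) / a)^l\<close> is at most \<open>l! exp 1 (exp (1 / a))^r\<close>, which only rescales \<open>z\<close>.
\<close>
lemma summable_power_exp_series:
  fixes a z :: real
  assumes "a > 0"
  shows "summable (\<lambda>r. ((a + real r) / a) ^ l * (z ^ r / fact r))"
proof (rule summable_comparison_test')
  show "summable (\<lambda>r. fact l * exp 1 * (inverse (fact r) * (exp (1 / a) * \<bar>z\<bar>) ^ r))"
    by (intro summable_mult summable_exp)
  fix r :: nat
  define y where "y = (a + real r) / a"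
  have "y \<ge> 0" and y: "y = 1 + real r * (1 / a)"
    using assms by (auto simp: y_def field_simps)
  have "y ^ l / fact l \<le> exp y"
  proof -
    have "(\<Sum>i\<in>{l}. inverse (fact i) * y ^ i) \<le> (\<Sum>i. inverse (fact i) * y ^ i)"
      using \<open>y \<ge> 0\<close> by (intro sum_le_suminf summable_exp) auto
    then show ?thesis
      by (simp add: exp_def divide_inverse mult.commute)
  qed
  then have "y ^ l \<le> fact l * (exp 1 * exp (1 / a) ^ r)"
    by (simp add: field_simps y exp_add exp_of_nat_mult del: times_divide_eq_right)
  then have "y ^ l * (\<bar>z\<bar> ^ r / fact r)
      \<le> fact l * (exp 1 * exp (1 / a) ^ r) * (\<bar>z\<bar> ^ r / fact r)"
    by (rule mult_right_mono) simp
  then show "norm (((a + real r) / a) ^ l * (z ^ r / fact r))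
      \<le> fact l * exp 1 * (inverse (fact r) * (exp (1 / a) * \<bar>z\<bar>) ^ r)"
    unfolding y_def[symmetric] using \<open>y \<ge> 0\<close>
    by (simp add: abs_mult power_abs divide_inverse power_mult_distrib mult_ac)
qed

lemma hypergeom_replicate_sums:
  fixes a z :: real
  assumes "a > 0"
  shows "(\<lambda>r. ((a + real r) / a) ^ l * (z ^ r / fact r))
    sums hypergeom (replicate l (a + 1)) (replicate l a) z"
proof -
  have "hypergeom (replicate l (a + 1)) (replicate l a) z
      = (\<Sum>r. ((a + real r) / a) ^ l * (z ^ r / fact r))"
    unfolding hypergeom_def
    using assms by (simp add: pochhammer_quotient_add_1 flip: power_divide)
  then show ?thesis
    using summable_power_exp_series[OF assms] by (simp add: summable_sums)
qed

text \<open>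
  Multiplication by \<open>t\<close> moves the coefficient at \<open>r\<close> to \<open>u = r + 1\<close> and rescales the factorial,
  which raises the exponent of \<open>u\<close> by one. At \<open>u = 0\<close> the truncated \<open>u - 1\<close> is harmless because
  \<open>0 ^ Suc l\<close> vanishes.
\<close>
lemma times_hypergeom_replicate_sums:
  fixes c t :: real
  shows "(\<lambda>u. real u ^ Suc l * c ^ (u - 1) * (t ^ u / fact u))
    sums (t * hypergeom (replicate l (1 + 1)) (replicate l 1) (c * t))"
proof (rule sums_Suc_imp)
  have "(\<lambda>r. t * (((1 + real r) / 1) ^ l * ((c * t) ^ r / fact r)))
      sums (t * hypergeom (replicate l (1 + 1)) (replicate l 1) (c * t))"
    by (intro sums_mult hypergeom_replicate_sums) simp
  moreover have "t * (((1 + real r) / 1) ^ l * ((c * t) ^ r / fact r))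
      = real (Suc r) ^ Suc l * c ^ (Suc r - 1) * (t ^ Suc r / fact (Suc r))" for r
    by (simp add: power_mult_distrib divide_simps)
  ultimately show "(\<lambda>r. real (Suc r) ^ Suc l * c ^ (Suc r - 1) * (t ^ Suc r / fact (Suc r)))
      sums (t * hypergeom (replicate l (1 + 1)) (replicate l 1) (c * t))"
    by (simp only:)
qed simp

lemma S2_sums:
  "(\<lambda>u. (1 - x) / 2 * (\<Sum>j=0..m. \<alpha> j *
        (\<Sum>l=0..j. real (j choose l) * (- (2 / real n)) ^ (j - l) *
          (real u ^ Suc l * ((1 + x) / 2) ^ (u - 1)))) * (t ^ u / fact u))
    sums S2 t x m 1 n \<alpha>"
proof -
  define C where "C j l = real (j choose l) * (- (2 / real n)) ^ (j - l)" for j l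
  define H where "H l = hypergeom (replicate l (1 + 1)) (replicate l 1) ((1 + x) / 2 * t)" for l
  have "(\<lambda>u. (1 - x) / 2 * (\<Sum>j=0..m. \<alpha> j * (\<Sum>l=0..j. C j l *
          (real u ^ Suc l * ((1 + x) / 2) ^ (u - 1) * (t ^ u / fact u)))))
      sums ((1 - x) / 2 * (\<Sum>j=0..m. \<alpha> j * (\<Sum>l=0..j. C j l * (t * H l))))"
    unfolding H_def by (intro sums_mult sums_sum times_hypergeom_replicate_sums)
  moreover have "(1 - x) / 2 * (\<Sum>j=0..m. \<alpha> j * (\<Sum>l=0..j. C j l * (t * H l)))
      = S2 t x m 1 n \<alpha>"
    by (simp add: S2_def C_def H_def sum_distrib_left mult_ac)
  ultimately show ?thesis
    by (simp add: C_def sum_distrib_left sum_distrib_right mult_ac)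
qed

section \<open>Uniqueness of the coefficients\<close>

text \<open>
  If the coefficients below \<open>n\<close> vanish, dividing the series by \<open>t ^ n\<close> and letting \<open>t\<close> tend
  to 0 isolates the coefficient at \<open>n\<close>.
\<close>
lemma powser_sums_zero_imp_coeff_zero:
  fixes a :: "nat \<Rightarrow> 'a::{real_normed_field,banach}"
  assumes "\<And>t. (\<lambda>u. a u * t ^ u) sums 0"
  shows "a n = 0"
proof (induction n rule: less_induct)
  case (less n)
  have "(\<lambda>u. a (u + n) * t ^ u) sums 0" if "t \<noteq> 0" for t
  proof -
    have "(\<lambda>u. a (u + n) * t ^ (u + n)) sums 0"
      using assms[of t] less by (subst sums_iff_shift) simp
    from sums_divide[OF this, of "t ^ n"] show ?thesis
      using that by (simp add: power_add)
  qed
  then have "((\<lambda>_. 0) \<longlongrightarrow> a (0 + n)) (at (0 :: 'a))"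
    by (intro powser_limit_0_strong[where s = 1 and a = "\<lambda>u. a (u + n)"]) auto
  then show ?case
    by (simp add: tendsto_const_iff)
qed

lemma b2_eqI:
  assumes "\<And>t. (\<lambda>u. b u * (t ^ u / fact u)) sums S2 t x m k n \<alpha>"
  shows "b2 v x m k n \<alpha> = b v"
proof -
  have "b' = b" if b': "\<forall>t. (\<lambda>u. b' u * (t ^ u / fact u)) sums S2 t x m k n \<alpha>" for b'
  proof
    fix u
    have "(\<lambda>u. (b' u - b u) / fact u * t ^ u) sums 0" for t
      using sums_diff[OF b'[rule_format, of t] assms[of t]]
      by (simp add: algebra_simps diff_divide_distrib)
    from powser_sums_zero_imp_coeff_zero[OF this, of u] show "b' u = b u"
      by simp
  qed
  then have "(THE b. \<forall>t. (\<lambda>u. b u * (t ^ u / fact u)) sums S2 t x m k n \<alpha>) = b"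
    by (intro the_equality allI assms)
  then show ?thesis
    by (simp add: b2_def)
qed

section \<open>The coefficients for \<open>k = 1\<close>\<close>

theorem theorem2p18:
  fixes x :: real and m v n :: nat and \<alpha> :: "nat \<Rightarrow> real"
  assumes "x > 1" and "n \<ge> 1"
  shows "b2 v x m 1 n \<alpha> =
    (1 - x) * (\<Sum>j=0..m. \<alpha> j *
      (\<Sum>l=0..j. real (j choose l) * (- (2 / real n)) ^ (j - l) *
        (\<Sum>c=0..l. real (v choose (c + 1)) *
          fact (c + 1) * stirling2 (l + 1) (c + 1) * (1 + x) powi (int v - 1) / 2 ^ v)))"
proof -
  \<comment> \<open>For \<open>v = 0\<close> the integer and the truncated \<open>v - 1\<close> differ, but both sides vanish.\<close>
  have inner: "(\<Sum>c=0..l. real (v choose (c + 1)) *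
        fact (c + 1) * stirling2 (l + 1) (c + 1) * (1 + x) powi (int v - 1) / 2 ^ v)
      = 1 / 2 * (real v ^ Suc l * ((1 + x) / 2) ^ (v - 1))" for l
  proof (cases v)
    case (Suc w)
    then have "int v - 1 = int w"
      by simp
    then have "(\<Sum>c=0..l. real (v choose (c + 1)) *
        fact (c + 1) * stirling2 (l + 1) (c + 1) * (1 + x) powi (int v - 1) / 2 ^ v)
      = real v ^ Suc l * (1 + x) ^ w / 2 ^ v"
      unfolding power_Suc_eq_sum_stirling2
      by (simp only: power_int_of_nat sum_distrib_right sum_divide_distrib)
    also have "\<dots> = 1 / 2 * (real v ^ Suc l * ((1 + x) / 2) ^ (v - 1))"
      by (simp add: Suc power_divide)
    finally show ?thesis .
  qed simp
  have "b2 v x m 1 n \<alpha> = (1 - x) / 2 * (\<Sum>j=0..m. \<alpha> j *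
      (\<Sum>l=0..j. real (j choose l) * (- (2 / real n)) ^ (j - l) *
        (real v ^ Suc l * ((1 + x) / 2) ^ (v - 1))))"
    by (rule b2_eqI) (rule S2_sums)
  then show ?thesis
    by (simp only: inner) (simp add: sum_distrib_left mult_ac)
qed

end
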